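(* Let $\tau>0$ and let $\delta,p:\mathbb{R}\to\mathbb{R}$ be positive almost automorphic functions such that the mean of $\delta$ satisfies $M(\delta)>\delta_->0$ for some constant $\delta_-$. Then for $\gamma$ sufficiently small (i.e. there is $\gamma_0>0$, depending on the given data $\delta,p,\tau$, such that the following holds whenever $0<\gamma<\gamma_0$), for every positive Lipschitz function $g:\mathbb{R}\to\mathbb{R}$ with Lipschitz constant $\gamma$, the equation $$y'(t)=-\delta(t)y(t)+p(t)g(y(t-\tau))$$ has a unique almost automorphic solution.
   Context: A continuous function $\psi:\mathbb{R}\to\mathbb{R}$ is almost automorphic if every real sequence has a subsequence $\{\tau_n\}$ for which $\tilde\psi(t)=\lim_n\psi(t+\tau_n)$ and $\psi(t)=\lim_n\tilde\psi(t-\tau_n)$ (pointwise) for all $t\in\mathbb{R}$. A bounded continuous function $h$ is ergodic if the limit $M(h)=\lim_{T\to\infty}\frac1{2T}\int_{-T+\xi}^{T+\xi}h(s)\,ds$ exists uniformly with respect to $\xi\in\mathbb{R}$ and is independent of $\xi$; $M(h)$ is its mean. The hypothesis on $M(\delta)$ includes that $\delta$ is ergodic. *)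

theory Defs
  imports "HOL-Analysis.Analysis"
begin

definition almost_automorphic :: "(real \<Rightarrow> real) \<Rightarrow> bool" where
  "almost_automorphic \<psi> \<longleftrightarrow>
     continuous_on UNIV \<psi> \<and>
     (\<forall>s :: nat \<Rightarrow> real. \<exists>r :: nat \<Rightarrow> nat. strict_mono r \<and>
        (\<exists>\<psi>' :: real \<Rightarrow> real. \<forall>t.
           (\<lambda>n. \<psi> (t + s (r n))) \<longlonglongrightarrow> \<psi>' t \<and>
           (\<lambda>n. \<psi>' (t - s (r n))) \<longlonglongrightarrow> \<psi> t))"

text \<open>The averages converge uniformly in the centre \<open>\<xi>\<close> of the window; the limit being the
  constant \<open>m\<close> expresses that it does not depend on \<open>\<xi>\<close>.\<close>

definition has_mean :: "(real \<Rightarrow> real) \<Rightarrow> real \<Rightarrow> bool" where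
  "has_mean h m \<longleftrightarrow>
     uniform_limit UNIV (\<lambda>T \<xi>. 1 / (2 * T) * integral {-T + \<xi>..T + \<xi>} h) (\<lambda>\<xi>. m) at_top"

definition ergodic :: "(real \<Rightarrow> real) \<Rightarrow> bool" where
  "ergodic h \<longleftrightarrow> bounded (range h) \<and> continuous_on UNIV h \<and> (\<exists>m. has_mean h m)"

text \<open>Only meaningful for ergodic functions.\<close>

definition mean :: "(real \<Rightarrow> real) \<Rightarrow> real" where
  "mean h = (THE m. has_mean h m)"

definition delay_solution ::
  "real \<Rightarrow> (real \<Rightarrow> real) \<Rightarrow> (real \<Rightarrow> real) \<Rightarrow> (real \<Rightarrow> real) \<Rightarrow> (real \<Rightarrow> real) \<Rightarrow> bool" where
  "delay_solution \<tau> \<delta> p g y \<longleftrightarrow>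
     (\<forall>t. (y has_real_derivative (- \<delta> t * y t + p t * g (y (t - \<tau>)))) (at t))"

end

theory Submission
  imports Defs
begin

text \<open>A positive mean of \<open>\<delta>\<close> forces exponential decay of the kernel
  \<open>exp (- \<integral>\<^sub>s\<^sup>t \<delta>)\<close>, so the bounded solutions of the delay equation are the fixed points of
  \<open>y \<mapsto> \<integral>\<^sub>0\<^sup>\<infinity> exp (- \<integral>\<^bsub>t-u\<^esub>\<^sup>t \<delta>) p(t-u) g(y(t-u-\<tau>)) du\<close>, which is a contraction in the supremum norm once
  \<open>\<gamma>\<close> is small. By dominated convergence the operator commutes with limits along translations,
  forwards to the limit functions and back again, so its fixed point is almost automorphic. All
  integrals are gauge integrals: then integrability of the limit functions, which need not be
  continuous, comes from dominated convergence itself.\<close>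

section \<open>Exponentially damped integrals\<close>

text \<open>Variation of constants started at minus infinity, for \<open>y' = - a y + f\<close>. The
  variable \<open>u = t - s\<close> is the elapsed time, which keeps the domain \<open>{0..}\<close>
  the same for all \<open>t\<close>.\<close>

definition damped :: "(real \<Rightarrow> real) \<Rightarrow> (real \<Rightarrow> real) \<Rightarrow> real \<Rightarrow> real" where
  "damped a f t = integral {0..} (\<lambda>u. exp (- integral {t - u..t} a) * f (t - u))"

text \<open>Integrability stands in place of continuity so that the property, with the same
  \<open>A\<close>, \<open>K\<close> and \<open>m\<close>, passes to translates and to pointwise
  limits of translates.\<close>

definition dissipative :: "real \<Rightarrow> real \<Rightarrow> real \<Rightarrow> (real \<Rightarrow> real) \<Rightarrow> bool" where
  "dissipative A K m a \<longleftrightarrow> (\<forall>t. \<bar>a t\<bar> \<le> A) \<and> (\<forall>s t. a integrable_on {s..t}) \<and>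
     (\<forall>s t. s \<le> t \<longrightarrow> exp (- integral {s..t} a) \<le> K * exp (- m * (t - s)))"

text \<open>Integrability of the weighted integrand is part of the notion because a limit
  \<open>f\<close> may be discontinuous; it is inherited by dominated convergence.\<close>

definition forcing :: "real \<Rightarrow> (real \<Rightarrow> real) \<Rightarrow> (real \<Rightarrow> real) \<Rightarrow> bool" where
  "forcing B a f \<longleftrightarrow> (\<forall>t. \<bar>f t\<bar> \<le> B) \<and>
     (\<forall>t. (\<lambda>u. exp (- integral {t - u..t} a) * f (t - u)) integrable_on {0..})"

lemma forcing_bound: "forcing B a f \<Longrightarrow> \<bar>f t\<bar> \<le> B"
  by (simp add: forcing_def)

lemma forcing_integrable:
  "forcing B a f \<Longrightarrow> (\<lambda>u. exp (- integral {t - u..t} a) * f (t - u)) integrable_on {0..}"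
  by (simp add: forcing_def)

lemma dissipative_kernel:
  "dissipative A K m a \<Longrightarrow> u \<ge> 0 \<Longrightarrow> exp (- integral {t - u..t} a) \<le> K * exp (- m * u)"
  unfolding dissipative_def by (metis (no_types, lifting) diff_diff_eq2 add_diff_cancel_left' diff_ge_0_iff_ge)

lemma dissipative_const_pos: "dissipative A K m a \<Longrightarrow> K > 0"
proof -
  assume "dissipative A K m a"
  from dissipative_kernel[OF this, of 0 0] have "1 \<le> K" by simp
  then show ?thesis by simp
qed

lemma integrand_bound:
  assumes "dissipative A K m a" "\<And>t. \<bar>f t\<bar> \<le> B" "u \<ge> 0"
  shows "\<bar>exp (- integral {t - u..t} a) * f (t - u)\<bar> \<le> B * K * exp (- m * u)"
proof -
  have "exp (- integral {t - u..t} a) * \<bar>f (t - u)\<bar> \<le> (K * exp (- m * u)) * B"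
    using dissipative_kernel[OF assms(1,3)] assms(2)
    by (intro mult_mono) (auto intro: order_trans[OF exp_ge_zero])
  then show ?thesis by (simp add: abs_mult algebra_simps)
qed

lemma exp_bound_has_integral:
  fixes B K m :: real
  assumes "m > 0"
  shows "((\<lambda>u. B * K * exp (- m * u)) has_integral (B * K / m)) {0..}"
  using has_integral_mult_right[OF has_integral_exp_minus_to_infinity[OF assms, of 0], of "B * K"]
  by simp

lemma damped_bound:
  assumes "dissipative A K m a" "forcing B a f" "m > 0"
  shows "\<bar>damped a f t\<bar> \<le> B * K / m"
proof -
  have "norm (damped a f t) \<le> integral {0..} (\<lambda>u. B * K * exp (- m * u))"
    unfolding damped_def
  proof (rule integral_norm_bound_integral)
    show "(\<lambda>u. B * K * exp (- m * u)) integrable_on {0..}"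
      using exp_bound_has_integral[OF assms(3)] by blast
    show "norm (exp (- integral {t - u..t} a) * f (t - u)) \<le> B * K * exp (- m * u)" if "u \<in> {0..}" for u
      using integrand_bound[OF assms(1) forcing_bound[OF assms(2)], of u t] that by simp
  qed (rule forcing_integrable[OF assms(2)])
  also have "\<dots> = B * K / m"
    using exp_bound_has_integral[OF assms(3)] by (rule integral_unique)
  finally show ?thesis by simp
qed

lemma damped_diff:
  assumes "forcing B a f" "forcing C a h"
  shows "damped a (\<lambda>t. f t - h t) t = damped a f t - damped a h t"
  unfolding damped_def right_diff_distrib
  by (intro integral_diff forcing_integrable[OF assms(1)] forcing_integrable[OF assms(2)])

lemma integral_translate:
  fixes a :: "real \<Rightarrow> real"
  shows "integral {s..t} (\<lambda>v. a (v + c)) = integral {s + c..t + c} a"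
  using integral_shift_real_ivl[of "s + c" c "t + c" a] by simp

lemma dissipative_translate:
  assumes "dissipative A K m a"
  shows "dissipative A K m (\<lambda>v. a (v + c))"
proof -
  have "(\<lambda>v. a (v + c)) integrable_on {s..t}" for s t
    using integrable_shift_real_ivl[of a "s + c" "t + c" c] assms by (simp add: dissipative_def)
  moreover have "exp (- integral {s + c..t + c} a) \<le> K * exp (- m * (t - s))" if "s \<le> t" for s t
    using assms that unfolding dissipative_def
    by (metis add_diff_cancel_right add_le_cancel_right)
  ultimately show ?thesis
    using assms by (simp add: dissipative_def integral_translate)
qed

lemma damped_translate: "damped (\<lambda>v. a (v + c)) (\<lambda>v. f (v + c)) t = damped a f (t + c)"
  by (simp add: damped_def integral_translate algebra_simps)

lemma forcing_translate:
  assumes "forcing B a f"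
  shows "forcing B (\<lambda>v. a (v + c)) (\<lambda>v. f (v + c))"
  using forcing_bound[OF assms] forcing_integrable[OF assms, of "t + c" for t]
  by (simp add: forcing_def integral_translate algebra_simps)

text \<open>The constant \<open>A\<close> dominates on every compact interval, and both inequalities
  in \<open>dissipative\<close> are closed under limits.\<close>

lemma dissipative_limit:
  assumes a: "\<And>n. dissipative A K m (a n)" and lim: "\<And>t. (\<lambda>n. a n t) \<longlonglongrightarrow> b t"
  shows "dissipative A K m b" and "(\<lambda>n. integral {s..t} (a n)) \<longlonglongrightarrow> integral {s..t} b"
proof -
  have dom: "b integrable_on {s..t} \<and> (\<lambda>n. integral {s..t} (a n)) \<longlonglongrightarrow> integral {s..t} b" for s t
    using dominated_convergence[of a "{s..t}" "\<lambda>_. A" b] a lim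
    by (auto simp: dissipative_def)
  then show "(\<lambda>n. integral {s..t} (a n)) \<longlonglongrightarrow> integral {s..t} b" by blast
  have "\<bar>b t\<bar> \<le> A" for t
    using tendsto_rabs[OF lim, of t] a
    by (intro LIMSEQ_le_const2) (auto simp: dissipative_def)
  moreover have "exp (- integral {s..t} b) \<le> K * exp (- m * (t - s))" if "s \<le> t" for s t
  proof (rule LIMSEQ_le_const2)
    show "(\<lambda>n. exp (- integral {s..t} (a n))) \<longlonglongrightarrow> exp (- integral {s..t} b)"
      using dom by (intro tendsto_intros) auto
  qed (use a that in \<open>auto simp: dissipative_def\<close>)
  ultimately show "dissipative A K m b"
    using dom by (simp add: dissipative_def)
qed

text \<open>The majorant \<open>B * K * exp (- m * u)\<close> serves all \<open>n\<close> and
  \<open>t\<close>, and the kernels converge by the preceding lemma.\<close>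

lemma damped_limit:
  assumes m: "m > 0"
    and a: "\<And>n. dissipative A K m (a n)" "\<And>t. (\<lambda>n. a n t) \<longlonglongrightarrow> b t"
    and f: "\<And>n. forcing B (a n) (f n)" "\<And>t. (\<lambda>n. f n t) \<longlonglongrightarrow> h t"
  shows "forcing B b h" and "(\<lambda>n. damped (a n) (f n) t) \<longlonglongrightarrow> damped b h t"
proof -
  have lim: "(\<lambda>n. exp (- integral {t - u..t} (a n)) * f n (t - u)) \<longlonglongrightarrow>
      exp (- integral {t - u..t} b) * h (t - u)" for t u
    by (intro tendsto_intros dissipative_limit(2)[OF a] f(2))
  have int: "(\<lambda>u. B * K * exp (- m * u)) integrable_on {0..}"
    using exp_bound_has_integral[OF m] by blast
  have "norm (exp (- integral {t - u..t} (a n)) * f n (t - u)) \<le> B * K * exp (- m * u)"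
    if "u \<in> {0..}" for n t u
    using integrand_bound[OF a(1)[of n] forcing_bound[OF f(1)[of n]], of u t] that by simp
  note dom = dominated_convergence[OF forcing_integrable[OF f(1)] int this lim]
  show "(\<lambda>n. damped (a n) (f n) t) \<longlonglongrightarrow> damped b h t"
    unfolding damped_def by (rule dom(2)) auto
  have "\<bar>h t\<bar> \<le> B" for t
    using tendsto_rabs[OF f(2), of t] forcing_bound[OF f(1)] by (intro LIMSEQ_le_const2) auto
  then show "forcing B b h"
    unfolding forcing_def using dom(1) by blast
qed

section \<open>Limits along a sequence of translations\<close>

text \<open>The two limits of almost automorphy along one given sequence, detached from the
  extraction of a subsequence, so that several functions can be followed along the same
  sequence.\<close>

definition limit_pair :: "(nat \<Rightarrow> real) \<Rightarrow> (real \<Rightarrow> real) \<Rightarrow> (real \<Rightarrow> real) \<Rightarrow> bool" where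
  "limit_pair s \<psi> \<psi>' \<longleftrightarrow>
     (\<forall>t. (\<lambda>n. \<psi> (t + s n)) \<longlonglongrightarrow> \<psi>' t \<and> (\<lambda>n. \<psi>' (t - s n)) \<longlonglongrightarrow> \<psi> t)"

lemma almost_automorphic_iff:
  "almost_automorphic \<psi> \<longleftrightarrow> continuous_on UNIV \<psi> \<and>
     (\<forall>s :: nat \<Rightarrow> real. \<exists>r. strict_mono r \<and> (\<exists>\<psi>'. limit_pair (s \<circ> r) \<psi> \<psi>'))"
  unfolding almost_automorphic_def limit_pair_def comp_def ..

lemma limit_pair_subseq:
  assumes "limit_pair s \<psi> \<psi>'" "strict_mono r"
  shows "limit_pair (s \<circ> r) \<psi> \<psi>'"
  using assms LIMSEQ_subseq_LIMSEQ[OF _ assms(2), unfolded comp_def]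
  unfolding limit_pair_def comp_def by blast

text \<open>\<open>damped\<close> commutes with translations, so both directions are instances of
  \<open>damped_limit\<close>. The backward one applies because \<open>b\<close> and
  \<open>h\<close> inherit the bounds of \<open>a\<close> and \<open>f\<close>, and their translates
  keep them.\<close>

lemma limit_pair_damped:
  assumes "m > 0" "dissipative A K m a" "limit_pair s a b" "forcing B a f" "limit_pair s f h"
  shows "limit_pair s (damped a f) (damped b h)"
proof -
  have a: "dissipative A K m (\<lambda>v. a (v + s n))" and f: "forcing B (\<lambda>v. a (v + s n)) (\<lambda>v. f (v + s n))" for n
    using assms by (auto intro: dissipative_translate forcing_translate)
  have lim: "(\<lambda>n. a (t + s n)) \<longlonglongrightarrow> b t" "(\<lambda>n. f (t + s n)) \<longlonglongrightarrow> h t"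
    "(\<lambda>n. b (t - s n)) \<longlonglongrightarrow> a t" "(\<lambda>n. h (t - s n)) \<longlonglongrightarrow> f t" for t
    using assms by (auto simp: limit_pair_def)
  note b = dissipative_limit(1)[OF a lim(1)]
  note h = damped_limit(1)[OF assms(1) a lim(1) f lim(2)]
  have b': "dissipative A K m (\<lambda>v. b (v - s n))" and h': "forcing B (\<lambda>v. b (v - s n)) (\<lambda>v. h (v - s n))" for n
    using dissipative_translate[OF b, of "- s n"] forcing_translate[OF h, of "- s n"] by simp_all
  show ?thesis
    unfolding limit_pair_def
    using damped_limit(2)[OF assms(1) a lim(1) f lim(2)] damped_limit(2)[OF assms(1) b' lim(3) h' lim(4)]
      damped_translate[of a "s n" f for n] damped_translate[of b "- s n" h for n]
    by simp
qed

text \<open>A three-epsilon argument: closeness in the supremum metric is uniform in the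
  translations. The Cauchy criterion produces \<open>l'\<close> along \<open>s\<close> itself,
  without passing to a subsequence.\<close>

lemma limit_pair_uniform_limit:
  fixes y :: "nat \<Rightarrow> real \<Rightarrow>\<^sub>C real"
  assumes lim: "y \<longlonglongrightarrow> l" and y: "\<And>k. limit_pair s (y k) (y' k)"
  shows "\<exists>l'. limit_pair s l l'"
proof -
  have fwd: "(\<lambda>n. y k (t + s n)) \<longlonglongrightarrow> y' k t" and bwd: "(\<lambda>n. y' k (t - s n)) \<longlonglongrightarrow> y k t" for k t
    using y by (auto simp: limit_pair_def)
  have close: "\<exists>k. \<forall>t. \<bar>y k t - l t\<bar> < e" if "e > 0" for e
  proof -
    obtain k where "dist (y k) l < e"
      using lim \<open>e > 0\<close> by (meson lim_sequentially order_refl)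
    then have "\<bar>y k t - l t\<bar> < e" for t
      using dist_fun_lt_imp_dist_val_lt by (metis dist_real_def)
    then show ?thesis by blast
  qed
  have "convergent (\<lambda>n. l (t + s n))" for t
    unfolding Cauchy_convergent_iff[symmetric]
  proof (rule metric_CauchyI)
    fix e :: real assume "e > 0"
    then obtain k where k: "\<And>t. \<bar>y k t - l t\<bar> < e / 3" using close[of "e / 3"] by auto
    obtain N where N: "\<And>i j. i \<ge> N \<Longrightarrow> j \<ge> N \<Longrightarrow> \<bar>y k (t + s i) - y k (t + s j)\<bar> < e / 3"
      using metric_CauchyD[OF LIMSEQ_imp_Cauchy[OF fwd[of k t]], of "e / 3"] \<open>e > 0\<close>
      by (auto simp: dist_real_def)
    have "dist (l (t + s i)) (l (t + s j)) < e" if "i \<ge> N" "j \<ge> N" for i j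
      using N[OF that] k[of "t + s i"] k[of "t + s j"] unfolding dist_real_def by linarith
    then show "\<exists>N. \<forall>i\<ge>N. \<forall>j\<ge>N. dist (l (t + s i)) (l (t + s j)) < e" by blast
  qed
  then obtain l' where l': "\<And>t. (\<lambda>n. l (t + s n)) \<longlonglongrightarrow> l' t"
    unfolding convergent_def by metis
  have "(\<lambda>n. l' (t - s n)) \<longlonglongrightarrow> l t" for t
  proof (rule metric_LIMSEQ_I)
    fix e :: real assume "e > 0"
    then obtain k where k: "\<And>t. \<bar>y k t - l t\<bar> < e / 3" using close[of "e / 3"] by auto
    \<comment> \<open>The uniform estimate between \<open>y k\<close> and \<open>l\<close> passes to
      their limits, weakened from strict to non-strict.\<close>
    have k': "\<bar>y' k v - l' v\<bar> \<le> e / 3" for v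
      using tendsto_rabs[OF tendsto_diff[OF fwd[of k v] l'[of v]]] k
      by (intro LIMSEQ_le_const2) (auto intro: less_imp_le)
    obtain N where N: "\<And>n. n \<ge> N \<Longrightarrow> \<bar>y' k (t - s n) - y k t\<bar> < e / 3"
      using metric_LIMSEQ_D[OF bwd[of k t], of "e / 3"] \<open>e > 0\<close> by (auto simp: dist_real_def)
    have "dist (l' (t - s n)) (l t) < e" if "n \<ge> N" for n
      using N[OF that] k'[of "t - s n"] k[of t] unfolding dist_real_def by linarith
    then show "\<exists>N. \<forall>n\<ge>N. dist (l' (t - s n)) (l t) < e" by blast
  qed
  with l' show ?thesis unfolding limit_pair_def by blast
qed

text \<open>Points with \<open>\<bar>\<psi> (s n)\<bar> > n\<close> would form a sequence of
  translations along which no subsequence converges at \<open>t = 0\<close>.\<close>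

lemma almost_automorphic_bounded:
  assumes "almost_automorphic \<psi>"
  shows "bounded (range \<psi>)"
proof (rule ccontr)
  assume "\<not> bounded (range \<psi>)"
  then have "\<exists>x. \<bar>\<psi> x\<bar> > real n" for n
    by (auto simp: bounded_iff not_le)
  then obtain s where s: "\<And>n. \<bar>\<psi> (s n)\<bar> > real n" by metis
  obtain r l where "strict_mono r" "limit_pair (s \<circ> r) \<psi> l"
    using assms almost_automorphic_iff by metis
  then have "(\<lambda>n. \<psi> (0 + (s \<circ> r) n)) \<longlonglongrightarrow> l 0" unfolding limit_pair_def by blast
  then have "Bseq (\<lambda>n. \<psi> (s (r n)))" by (auto intro: convergent_imp_Bseq convergentI)
  then obtain C where C: "\<And>n. \<bar>\<psi> (s (r n))\<bar> \<le> C" by (auto simp: Bseq_def)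
  obtain n where "real n > C" using reals_Archimedean2 by blast
  with C[of n] s[of "r n"] seq_suble[OF \<open>strict_mono r\<close>, of n] show False
    by (smt (verit) of_nat_mono)
qed

section \<open>The linear equation\<close>

text \<open>One antiderivative on the whole line: \<open>exp D\<close> is then a global integrating
  factor, and the kernel exponent becomes a difference of values of \<open>D\<close>.\<close>

lemma antiderivative_exists:
  fixes a :: "real \<Rightarrow> real"
  assumes "continuous_on UNIV a"
  obtains D where "\<And>t. (D has_real_derivative a t) (at t)"
proof -
  have "\<exists>F. \<forall>x::real. - \<infinity> < ereal x \<longrightarrow> ereal x < \<infinity> \<longrightarrow> (F has_vector_derivative a x) (at x)"
    using assms by (intro einterval_antiderivative) (auto simp: continuous_on_eq_continuous_at)
  then show thesis
    using that by (auto simp: has_real_derivative_iff_has_vector_derivative)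
qed

lemma integral_antiderivative:
  fixes D a :: "real \<Rightarrow> real"
  assumes "\<And>t. (D has_real_derivative a t) (at t)" "s \<le> t"
  shows "(a has_integral (D t - D s)) {s..t}"
  using assms
  by (intro fundamental_theorem_of_calculus)
     (auto intro: DERIV_subset simp flip: has_real_derivative_iff_has_vector_derivative)

lemma forcing_continuous:
  assumes "dissipative A K m a" "m > 0" "continuous_on UNIV a" "continuous_on UNIV f" "\<And>t. \<bar>f t\<bar> \<le> B"
  shows "forcing B a f"
proof -
  obtain D where D: "\<And>t. (D has_real_derivative a t) (at t)"
    using antiderivative_exists[OF assms(3)] by blast
  have contD: "continuous_on UNIV D"
    using D by (meson DERIV_isCont continuous_at_imp_continuous_on)
  have "(\<lambda>u. exp (- integral {t - u..t} a) * f (t - u)) integrable_on {0..}" for t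
  proof -
    \<comment> \<open>In terms of \<open>D\<close> the integrand is visibly continuous in
      \<open>u\<close>, hence measurable; the exponential majorant then gives integrability.\<close>
    have "(\<lambda>u. exp (- (D t - D (t - u))) * f (t - u)) integrable_on {0..}"
    proof (rule measurable_bounded_by_integrable_imp_integrable)
      show "(\<lambda>u. exp (- (D t - D (t - u))) * f (t - u)) \<in> borel_measurable (lebesgue_on {0..})"
        by (intro continuous_imp_measurable_on_sets_lebesgue continuous_intros
              continuous_on_compose2[OF contD] continuous_on_compose2[OF assms(4)]) auto
      show "(\<lambda>u. B * K * exp (- m * u)) integrable_on {0..}"
        using exp_bound_has_integral[OF assms(2)] by blast
      fix u :: real assume u: "u \<in> {0..}"
      then have "integral {t - u..t} a = D t - D (t - u)"
        by (intro integral_unique integral_antiderivative D) auto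
      then show "norm (exp (- (D t - D (t - u))) * f (t - u)) \<le> B * K * exp (- m * u)"
        using integrand_bound[OF assms(1,5), of u t] u by simp
    qed auto
    moreover have "integral {t - u..t} a = D t - D (t - u)" if "u \<in> {0..}" for u
      using that by (intro integral_unique integral_antiderivative D) auto
    ultimately show ?thesis
      by (subst integrable_cong) auto
  qed
  with assms(5) show ?thesis by (simp add: forcing_def)
qed

text \<open>Differentiation under the integral sign is avoided: the integral truncated at
  \<open>u = t + n\<close> is explicit in terms of \<open>D\<close> and \<open>E\<close>, and
  letting \<open>n\<close> grow yields a closed form that can be differentiated directly.\<close>

lemma damped_has_derivative:
  assumes "dissipative A K m a" "m > 0" "continuous_on UNIV a" "continuous_on UNIV f" "forcing B a f"
  shows "(damped a f has_real_derivative (- a t * damped a f t + f t)) (at t)"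
proof -
  obtain D where D: "\<And>t. (D has_real_derivative a t) (at t)"
    using antiderivative_exists[OF assms(3)] by blast
  have contD: "continuous_on UNIV D"
    using D by (meson DERIV_isCont continuous_at_imp_continuous_on)
  have "continuous_on UNIV (\<lambda>s. exp (D s) * f s)"
    by (intro continuous_intros contD assms)
  from antiderivative_exists[OF this]
  obtain E where E: "\<And>t. (E has_real_derivative (exp (D t) * f t)) (at t)" by blast
  \<comment> \<open>The left-hand side does not depend on \<open>t\<close>, so \<open>damped a f\<close> is \<open>exp (- D) * (E - L)\<close> for a constant \<open>L\<close>.\<close>
  have lim: "(\<lambda>n. E (- real n)) \<longlonglongrightarrow> E t - exp (D t) * damped a f t" for t
  proof -
    define h where "h u = exp (- integral {t - u..t} a) * f (t - u)" for u
    \<comment> \<open>The cut-off sits where \<open>t - u = - n\<close>; extension by zero gives all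
      \<open>n\<close> the common domain \<open>{0..}\<close> needed for dominated
      convergence.\<close>
    define c where "c n u = (if u \<in> {0..t + real n} then h u else 0)" for n :: nat and u
    have h_eq: "h u = exp (- D t) * (exp (D (t - u)) * f (t - u))" if "u \<ge> 0" for u
    proof -
      have "integral {t - u..t} a = D t - D (t - u)"
        using that by (intro integral_unique integral_antiderivative D) auto
      then show ?thesis by (simp add: h_def flip: exp_add mult.assoc)
    qed
    have h_int: "(h has_integral exp (- D t) * (E t - E (- real n))) {0..t + real n}" if "t + real n \<ge> 0" for n
    proof -
      have "((\<lambda>u. exp (- D t) * (exp (D (t - u)) * f (t - u))) has_integral
          (- exp (- D t) * E (t - (t + real n)) - (- exp (- D t) * E (t - 0)))) {0..t + real n}"
        by (rule integral_antiderivative)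
           (use that in \<open>auto intro!: derivative_eq_intros DERIV_chain2[OF E]\<close>)
      then have "((\<lambda>u. exp (- D t) * (exp (D (t - u)) * f (t - u))) has_integral
          exp (- D t) * (E t - E (- real n))) {0..t + real n}"
        by (simp add: algebra_simps)
      then show ?thesis
        by (rule has_integral_eq[rotated]) (simp add: h_eq)
    qed
    have ev: "\<forall>\<^sub>F n in sequentially. t + real n \<ge> x" for x
      using filterlim_tendsto_add_at_top[OF tendsto_const filterlim_real_sequentially, of t]
      by (simp add: filterlim_at_top)
    \<comment> \<open>For negative \<open>t\<close> the first intervals may be empty, so the index
      is shifted by \<open>N\<close>; \<open>LIMSEQ_offset\<close> undoes the shift.\<close>
    obtain N where N: "t + real N \<ge> 0"
      using ev[of 0] by (auto simp: eventually_sequentially)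
    have conv: "(\<lambda>n. c (n + N) u) \<longlonglongrightarrow> h u" if "u \<in> {0..}" for u
    proof (rule tendsto_eventually)
      show "\<forall>\<^sub>F n in sequentially. c (n + N) u = h u"
        by (rule eventually_mono[OF sequentially_offset[OF ev[of u], of N]])
           (use that in \<open>auto simp: c_def\<close>)
    qed
    have c_int: "(c (n + N) has_integral exp (- D t) * (E t - E (- real (n + N)))) {0..}" for n
    proof -
      have *: "{0..t + real (n + N)} \<subseteq> {0..}" by auto
      show ?thesis
        using has_integral_restrict[OF *, of h "exp (- D t) * (E t - E (- real (n + N)))"]
          h_int[of "n + N"] N
        by (simp add: c_def[abs_def])
    qed
    have "(\<lambda>n. integral {0..} (c (n + N))) \<longlonglongrightarrow> integral {0..} h"
    proof (rule dominated_convergence(2)[OF _ _ _ conv])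
      show "c (n + N) integrable_on {0..}" for n using c_int by blast
      show "(\<lambda>u. B * K * exp (- m * u)) integrable_on {0..}"
        using exp_bound_has_integral[OF assms(2)] by blast
      fix n u assume "u \<in> {0::real..}"
      then show "norm (c (n + N) u) \<le> B * K * exp (- m * u)"
        using integrand_bound[OF assms(1) forcing_bound[OF assms(5)], of u t]
        by (auto simp: c_def h_def intro: order_trans[OF abs_ge_zero])
    qed
    then have "(\<lambda>n. exp (- D t) * (E t - E (- real (n + N)))) \<longlonglongrightarrow> damped a f t"
      by (simp only: integral_unique[OF c_int] damped_def h_def[abs_def])
    then have "(\<lambda>n. E t - exp (D t) * (exp (- D t) * (E t - E (- real (n + N))))) \<longlonglongrightarrow>
        E t - exp (D t) * damped a f t"
      by (intro tendsto_intros)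
    then have "(\<lambda>n. E (- real (n + N))) \<longlonglongrightarrow> E t - exp (D t) * damped a f t"
      by (simp flip: mult.assoc exp_add)
    then show ?thesis by (rule LIMSEQ_offset)
  qed
  define L where "L = E 0 - exp (D 0) * damped a f 0"
  have "damped a f = (\<lambda>t. exp (- D t) * (E t - L))"
  proof
    fix t
    have "L = E t - exp (D t) * damped a f t"
      unfolding L_def by (rule LIMSEQ_unique[OF lim lim])
    then show "damped a f t = exp (- D t) * (E t - L)"
      by (simp flip: mult.assoc exp_add)
  qed
  moreover have "((\<lambda>t. exp (- D t) * (E t - L)) has_real_derivative
      - a t * (exp (- D t) * (E t - L)) + f t) (at t)"
    by (auto intro!: derivative_eq_intros D E simp flip: exp_add mult.assoc)
  ultimately show ?thesis by simp
qed

text \<open>Since \<open>exp D * w\<close> is constant, \<open>w t\<close> is the kernel over a time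
  span \<open>n\<close> times the bounded value \<open>w (t - n)\<close>, and the kernel decays as
  \<open>n\<close> grows.\<close>

lemma bounded_homogeneous_solution_zero:
  assumes "dissipative A K m a" "m > 0" "continuous_on UNIV a"
    and w: "\<And>t. (w has_real_derivative (- a t * w t)) (at t)" and W: "\<And>t. \<bar>w t\<bar> \<le> W"
  shows "w t = 0"
proof -
  obtain D where D: "\<And>t. (D has_real_derivative a t) (at t)"
    using antiderivative_exists[OF assms(3)] by blast
  have "((\<lambda>t. exp (D t) * w t) has_real_derivative 0) (at t)" for t
    by (auto intro!: derivative_eq_intros D w simp: algebra_simps)
  then have const: "exp (D t) * w t = exp (D s) * w s" for s t
    using DERIV_const_average DERIV_isconst_all by blast
  have "\<bar>w t\<bar> \<le> W * K * exp (- m * real n)" for n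
  proof -
    have "w t = exp (- (D t - D (t - real n))) * w (t - real n)"
      using const[of t "t - real n"] by (simp add: exp_diff field_simps)
    then have "\<bar>w t\<bar> = \<bar>exp (- integral {t - real n..t} a) * w (t - real n)\<bar>"
      using integral_unique[OF integral_antiderivative[OF D, of "t - real n" t]] by simp
    then show ?thesis
      using integrand_bound[OF assms(1) W, of "real n" t] by simp
  qed
  moreover have "(\<lambda>n. W * K * exp (- m * real n)) \<longlonglongrightarrow> W * K * 0"
    by (intro tendsto_intros filterlim_compose[OF exp_at_bot]
        filterlim_tendsto_neg_mult_at_bot[OF tendsto_const _ filterlim_real_sequentially])
       (use \<open>m > 0\<close> in auto)
  ultimately have "\<bar>w t\<bar> \<le> W * K * 0"
    by (intro LIMSEQ_le_const) auto
  then show ?thesis by simp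
qed

lemma bounded_solution_eq_damped:
  assumes "dissipative A K m a" "m > 0" "continuous_on UNIV a" "continuous_on UNIV f" "\<And>t. \<bar>f t\<bar> \<le> B"
    and y: "\<And>t. (y has_real_derivative (- a t * y t + f t)) (at t)" and Y: "\<And>t. \<bar>y t\<bar> \<le> Y"
  shows "y t = damped a f t"
proof -
  note f = forcing_continuous[OF assms(1-5)]
  have "y t - damped a f t = 0"
  proof (rule bounded_homogeneous_solution_zero[OF assms(1-3),
        where w = "\<lambda>t. y t - damped a f t" and W = "Y + B * K / m"])
    show "((\<lambda>t. y t - damped a f t) has_real_derivative - a t * (y t - damped a f t)) (at t)" for t
      by (rule derivative_eq_intros y damped_has_derivative[OF assms(1-4) f])+ (simp add: algebra_simps)
    show "\<bar>y t - damped a f t\<bar> \<le> Y + B * K / m" for t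
      using Y[of t] damped_bound[OF assms(1) f assms(2), of t] by simp
  qed
  then show ?thesis by simp
qed

section \<open>The delay equation\<close>

text \<open>By uniformity in the centre, all windows of length at least \<open>2 * T\<close> have
  average above \<open>m\<close>. On shorter windows positivity of \<open>a\<close> makes the kernel
  at most 1, and the constant \<open>exp (2 * m * T)\<close> compensates for the missing
  decay.\<close>

lemma has_mean_imp_dissipative:
  assumes h: "has_mean a \<mu>" "\<mu> > m" and m: "m > 0"
    and a: "continuous_on UNIV a" "\<And>t. a t > 0" "\<And>t. \<bar>a t\<bar> \<le> A"
  shows "\<exists>K. dissipative A K m a"
proof -
  have int: "a integrable_on {s..t}" for s t
    using a(1) continuous_on_subset integrable_continuous_real subset_UNIV by blast
  have "\<forall>\<^sub>F T in at_top. \<forall>\<xi>\<in>UNIV. dist (1 / (2 * T) * integral {- T + \<xi>..T + \<xi>} a) \<mu> < \<mu> - m"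
    using h by (intro uniform_limitD) (auto simp: has_mean_def)
  then obtain T where T: "T > 0"
    "\<And>S \<xi>. S \<ge> T \<Longrightarrow> dist (1 / (2 * S) * integral {- S + \<xi>..S + \<xi>} a) \<mu> < \<mu> - m"
    using eventually_conj[OF _ eventually_gt_at_top[of 0]] unfolding eventually_at_top_linorder
    by (metis (lifting) UNIV_I order_refl)
  have "exp (- integral {s..t} a) \<le> exp (2 * m * T) * exp (- m * (t - s))" if "s \<le> t" for s t
  proof (cases "t - s \<ge> 2 * T")
    case True
    \<comment> \<open>Half-length of the window \<open>{s..t}\<close>, whose centre is
      \<open>(s + t) / 2\<close>.\<close>
    define S where "S = (t - s) / 2"
    have S: "- S + (s + t) / 2 = s" "S + (s + t) / 2 = t" "S > 0" "S \<ge> T" "2 * S = t - s"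
      using True T(1) by (auto simp: S_def field_simps)
    from T(2)[of S "(s + t) / 2", unfolded S(1,2,5)] S(4) have "1 / (t - s) * integral {s..t} a > m"
      by (simp add: dist_real_def abs_less_iff)
    with \<open>S > 0\<close> \<open>2 * S = t - s\<close> have "integral {s..t} a > m * (t - s)"
      by (simp add: field_simps)
    moreover have "m * T > 0" using m T(1) by simp
    ultimately have "- integral {s..t} a \<le> 2 * m * T + - m * (t - s)" by simp
    then show ?thesis by (simp flip: exp_add)
  next
    case False
    then have "m * (t - s) \<le> m * (2 * T)" using m by (intro mult_left_mono) auto
    moreover have "integral {s..t} a \<ge> 0"
      using a(2) by (intro integral_nonneg int) (auto intro: less_imp_le)
    ultimately show ?thesis by (simp add: algebra_simps flip: exp_add)
  qed
  with int a(3) show ?thesis unfolding dissipative_def by blast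
qed

text \<open>Convergence at the centre 0 already determines the limit, so the description in
  \<open>mean\<close> is well defined.\<close>

lemma has_mean_mean:
  assumes "ergodic h"
  shows "has_mean h (mean h)"
proof -
  obtain m where m: "has_mean h m" using assms by (auto simp: ergodic_def)
  moreover have "m' = m" if "has_mean h m'" for m'
    using tendsto_uniform_limitI[OF that[unfolded has_mean_def], of 0]
      tendsto_uniform_limitI[OF m[unfolded has_mean_def], of 0]
    by (intro tendsto_unique[OF trivial_limit_at_top_linorder]) auto
  ultimately show ?thesis unfolding mean_def by (rule theI)
qed

lemma bounded_range_real_iff:
  fixes f :: "'a \<Rightarrow> real"
  shows "bounded (range f) \<longleftrightarrow> (\<exists>B. \<forall>x. \<bar>f x\<bar> \<le> B)"
  by (auto simp: bounded_iff)

section \<open>The fixed point operator of the delay equation\<close>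

context
  fixes \<tau> \<gamma> A K m P :: real and \<delta> p g :: "real \<Rightarrow> real"
  assumes \<delta>: "continuous_on UNIV \<delta>" "dissipative A K m \<delta>" and m: "m > 0"
    and p: "continuous_on UNIV p" "\<And>t. \<bar>p t\<bar> \<le> P"
    and g: "\<gamma>-lipschitz_on UNIV g"
    and small: "\<gamma> * P * K / m < 1"
begin

definition drive :: "(real \<Rightarrow> real) \<Rightarrow> real \<Rightarrow> real" where
  "drive y t = p t * g (y (t - \<tau>))"

lemma g_continuous: "continuous_on UNIV g"
  using g by (rule lipschitz_on_continuous_on)

lemma P_nonneg: "P \<ge> 0"
  using p(2)[of 0] by linarith

lemma rate_nonneg: "\<gamma> * P * K / m \<ge> 0"
  using lipschitz_on_nonneg[OF g] P_nonneg dissipative_const_pos[OF \<delta>(2)] m by simp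

lemma drive_continuous:
  assumes "continuous_on UNIV y"
  shows "continuous_on UNIV (drive y)"
proof -
  have "continuous_on UNIV (\<lambda>t. y (t - \<tau>))"
    by (rule continuous_on_compose2[OF assms]) (auto intro: continuous_intros)
  then have "continuous_on UNIV (\<lambda>t. g (y (t - \<tau>)))"
    by (rule continuous_on_compose2[OF g_continuous]) auto
  with p(1) show ?thesis
    unfolding drive_def by (rule continuous_on_mult)
qed

lemma drive_lipschitz:
  assumes "\<And>t. \<bar>y t - z t\<bar> \<le> d"
  shows "\<bar>drive y t - drive z t\<bar> \<le> \<gamma> * P * d"
proof -
  have "\<bar>g (y (t - \<tau>)) - g (z (t - \<tau>))\<bar> \<le> \<gamma> * \<bar>y (t - \<tau>) - z (t - \<tau>)\<bar>"
    using lipschitz_onD[OF g] by (simp add: dist_real_def)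
  also have "\<dots> \<le> \<gamma> * d"
    using lipschitz_on_nonneg[OF g] assms by (rule mult_left_mono[rotated])
  finally have "\<bar>p t\<bar> * \<bar>g (y (t - \<tau>)) - g (z (t - \<tau>))\<bar> \<le> P * (\<gamma> * d)"
    by (intro mult_mono p(2) P_nonneg) auto
  moreover have "drive y t - drive z t = p t * (g (y (t - \<tau>)) - g (z (t - \<tau>)))"
    by (simp add: drive_def right_diff_distrib)
  ultimately show ?thesis
    by (simp add: abs_mult mult_ac)
qed

text \<open>As \<open>g\<close> may be unbounded, the estimate compares \<open>y\<close> with the
  zero function, whose drive is at most \<open>P * \<bar>g 0\<bar>\<close>.\<close>

lemma drive_bounded:
  assumes "bounded (range y)"
  shows "\<exists>B. \<forall>t. \<bar>drive y t\<bar> \<le> B"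
proof -
  obtain Y where "\<And>t. \<bar>y t\<bar> \<le> Y" using assms unfolding bounded_range_real_iff by blast
  then have diff: "\<bar>drive y t - drive (\<lambda>_. 0) t\<bar> \<le> \<gamma> * P * Y" for t
    by (intro drive_lipschitz) auto
  have zero: "\<bar>drive (\<lambda>_. 0) t\<bar> \<le> P * \<bar>g 0\<bar>" for t
    using p(2) by (simp add: drive_def abs_mult mult_right_mono)
  have "\<bar>drive y t\<bar> \<le> \<gamma> * P * Y + P * \<bar>g 0\<bar>" for t
    using diff[of t] zero[of t] by linarith
  then show ?thesis by blast
qed

lemma drive_forcing:
  assumes "continuous_on UNIV y" "bounded (range y)"
  shows "\<exists>B. forcing B \<delta> (drive y)"
proof -
  obtain B where "\<And>t. \<bar>drive y t\<bar> \<le> B" using drive_bounded[OF assms(2)] by blast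
  from forcing_continuous[OF \<delta>(2) m \<delta>(1) drive_continuous[OF assms(1)] this] show ?thesis ..
qed

lemma drive_bcontfun_forcing:
  fixes y :: "real \<Rightarrow>\<^sub>C real"
  shows "\<exists>B. forcing B \<delta> (drive y)"
  by (rule drive_forcing) simp_all

text \<open>Bounded continuous functions form a complete metric space under the supremum metric.
  \<open>Bcontfun\<close> returns the intended function only for bounded continuous arguments, which
  \<open>apply_picard\<close> verifies.\<close>

definition picard :: "(real \<Rightarrow>\<^sub>C real) \<Rightarrow> (real \<Rightarrow>\<^sub>C real)" where
  "picard y = Bcontfun (damped \<delta> (drive y))"

lemma drive_bcontfun_derivative:
  fixes y :: "real \<Rightarrow>\<^sub>C real"
  shows "(damped \<delta> (drive y) has_real_derivative
    - \<delta> t * damped \<delta> (drive y) t + drive y t) (at t)"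
proof -
  obtain B where B: "forcing B \<delta> (drive y)" using drive_bcontfun_forcing ..
  show ?thesis
    by (rule damped_has_derivative[OF \<delta>(2) m \<delta>(1) drive_continuous B]) simp
qed

lemma apply_picard: "apply_bcontfun (picard y) = damped \<delta> (drive y)"
proof -
  obtain B where B: "forcing B \<delta> (drive y)" using drive_bcontfun_forcing ..
  then have "bounded (range (damped \<delta> (drive y)))"
    unfolding bounded_range_real_iff using damped_bound[OF \<delta>(2) B m] by blast
  moreover have "continuous_on UNIV (damped \<delta> (drive y))"
    using drive_bcontfun_derivative by (meson DERIV_isCont continuous_at_imp_continuous_on)
  ultimately show ?thesis
    unfolding picard_def by (intro Bcontfun_inverse) (simp add: bcontfun_def)
qed

text \<open>\<open>damped\<close> is linear in the forcing: the drives differ by at most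
  \<open>\<gamma> * P * dist y z\<close>, and \<open>damped_bound\<close> contributes the factor
  \<open>K / m\<close>.\<close>

lemma picard_contraction: "dist (picard y) (picard z) \<le> (\<gamma> * P * K / m) * dist y z"
proof (rule dist_bound)
  fix t
  obtain B C where BC: "forcing B \<delta> (drive y)" "forcing C \<delta> (drive z)"
    using drive_bcontfun_forcing by metis
  have "\<bar>drive y t - drive z t\<bar> \<le> \<gamma> * P * dist y z" for t
    by (intro drive_lipschitz) (metis dist_bounded dist_real_def)
  then have "forcing (\<gamma> * P * dist y z) \<delta> (\<lambda>t. drive y t - drive z t)"
    by (intro forcing_continuous[OF \<delta>(2) m \<delta>(1)] continuous_intros drive_continuous) auto
  from damped_bound[OF \<delta>(2) this m, of t] show "dist (picard y t) (picard z t) \<le> \<gamma> * P * K / m * dist y z"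
    by (simp add: apply_picard dist_real_def damped_diff[OF BC] algebra_simps)
qed

lemma picard_fixpoint_unique:
  assumes "picard y = y" "picard z = z"
  shows "y = z"
proof -
  have "dist y z \<le> (\<gamma> * P * K / m) * dist y z"
    using picard_contraction[of y z] assms by simp
  with small have "dist y z \<le> 0"
    by (metis mult_le_cancel_right1 not_le zero_le_dist)
  then show ?thesis by simp
qed

text \<open>Boundedness, built into the type of \<open>y\<close>, excludes homogeneous components.
  Uniqueness of the fixed point thus covers all bounded solutions.\<close>

lemma delay_solution_iff_picard:
  "delay_solution \<tau> \<delta> p g (apply_bcontfun y) \<longleftrightarrow> picard y = y"
proof
  assume sol: "delay_solution \<tau> \<delta> p g (apply_bcontfun y)"
  obtain B where B: "\<And>t. \<bar>drive y t\<bar> \<le> B" using drive_bounded[of y] by auto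
  obtain Y where Y: "\<And>t. \<bar>y t\<bar> \<le> Y" using bounded_apply_bcontfun[of y] unfolding bounded_range_real_iff by blast
  have "y t = damped \<delta> (drive y) t" for t
    using sol by (intro bounded_solution_eq_damped[OF \<delta>(2) m \<delta>(1) drive_continuous B _ Y])
      (auto simp: delay_solution_def drive_def)
  then show "picard y = y" by (intro bcontfun_eqI) (simp add: apply_picard)
next
  assume "picard y = y"
  then have "damped \<delta> (drive y) = y" by (metis apply_picard)
  with drive_bcontfun_derivative[of y] show "delay_solution \<tau> \<delta> p g (apply_bcontfun y)"
    by (simp add: delay_solution_def drive_def)
qed

text \<open>Fixing the sequence together with the limits of \<open>\<delta>\<close> and \<open>p\<close> along it makes this set closed
  without a diagonal extraction of subsequences.\<close>

definition hull_compatible :: "(real \<Rightarrow>\<^sub>C real) set" where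
  "hull_compatible = {y. \<forall>s \<delta>' p'. limit_pair s \<delta> \<delta>' \<and> limit_pair s p p' \<longrightarrow>
     (\<exists>y'. limit_pair s (apply_bcontfun y) y')}"

lemma closed_hull_compatible: "closed hull_compatible"
  unfolding closed_sequential_limits
proof (intro allI impI, elim conjE)
  fix y l assume y: "\<forall>n. y n \<in> hull_compatible" and lim: "y \<longlonglongrightarrow> l"
  have "\<exists>l'. limit_pair s l l'" if "limit_pair s \<delta> \<delta>'" "limit_pair s p p'" for s \<delta>' p'
  proof -
    have "\<forall>k. \<exists>y'. limit_pair s (y k) y'" using y that unfolding hull_compatible_def by blast
    then obtain y' where "\<And>k. limit_pair s (y k) (y' k)" by metis
    with lim show ?thesis by (rule limit_pair_uniform_limit)
  qed
  then show "l \<in> hull_compatible" unfolding hull_compatible_def by blast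
qed

text \<open>The delay merely shifts the evaluation point, and continuity of \<open>g\<close> carries
  both limits through the drive; \<open>limit_pair_damped\<close> does the rest.\<close>

lemma picard_hull_compatible:
  assumes "y \<in> hull_compatible"
  shows "picard y \<in> hull_compatible"
proof -
  have "\<exists>z. limit_pair s (damped \<delta> (drive y)) z" if s: "limit_pair s \<delta> \<delta>'" "limit_pair s p p'" for s \<delta>' p'
  proof -
    obtain y' where y': "limit_pair s y y'" using assms s unfolding hull_compatible_def by blast
    have y: "(\<lambda>n. y (t + s n - \<tau>)) \<longlonglongrightarrow> y' (t - \<tau>)" "(\<lambda>n. y' (t - s n - \<tau>)) \<longlonglongrightarrow> y (t - \<tau>)" for t
    proof -
      have eq: "t + s n - \<tau> = t - \<tau> + s n" "t - s n - \<tau> = t - \<tau> - s n" for n by auto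
      show "(\<lambda>n. y (t + s n - \<tau>)) \<longlonglongrightarrow> y' (t - \<tau>)" "(\<lambda>n. y' (t - s n - \<tau>)) \<longlonglongrightarrow> y (t - \<tau>)"
        unfolding eq using y' unfolding limit_pair_def by blast+
    qed
    have "isCont g x" for x
      using g_continuous by (simp add: continuous_on_eq_continuous_at)
    note g_lim = y[THEN isCont_tendsto_compose[OF this]]
    have "limit_pair s (drive y) (\<lambda>t. p' t * g (y' (t - \<tau>)))"
      using s(2) unfolding limit_pair_def drive_def by (intro allI conjI tendsto_mult g_lim) auto
    moreover obtain B where B: "forcing B \<delta> (drive y)" using drive_bcontfun_forcing ..
    ultimately show ?thesis using limit_pair_damped[OF m \<delta>(2) s(1)] by blast
  qed
  then show ?thesis unfolding hull_compatible_def by (auto simp: apply_picard)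
qed

text \<open>Two successive extractions, for \<open>\<delta>\<close> and then for \<open>p\<close>,
  suffice: \<open>y\<close> converges along the resulting sequence with no third one.\<close>

lemma hull_compatible_almost_automorphic:
  assumes "almost_automorphic \<delta>" "almost_automorphic p" "y \<in> hull_compatible"
  shows "almost_automorphic (apply_bcontfun y)"
  unfolding almost_automorphic_iff
proof (intro conjI allI)
  fix s :: "nat \<Rightarrow> real"
  obtain r \<delta>' where r: "strict_mono r" "limit_pair (s \<circ> r) \<delta> \<delta>'"
    using assms(1) unfolding almost_automorphic_iff by metis
  obtain q p' where q: "strict_mono q" "limit_pair (s \<circ> r \<circ> q) p p'"
    using assms(2) unfolding almost_automorphic_iff by metis
  then have "\<exists>y'. limit_pair (s \<circ> r \<circ> q) y y'"
    using assms(3) limit_pair_subseq[OF r(2) q(1)] unfolding hull_compatible_def by blast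
  then show "\<exists>r. strict_mono r \<and> (\<exists>y'. limit_pair (s \<circ> r) y y')"
    using strict_mono_o[OF r(1) q(1)] by (metis comp_assoc)
qed auto

lemma ex1_almost_automorphic_solution:
  assumes "almost_automorphic \<delta>" "almost_automorphic p"
  shows "\<exists>!y. almost_automorphic y \<and> delay_solution \<tau> \<delta> p g y"
proof -
  \<comment> \<open>The fixed point theorem needs a nonempty set; a constant is its own limit along
    every sequence.\<close>
  have "const_bcontfun 0 \<in> hull_compatible"
    by (auto simp: hull_compatible_def limit_pair_def const_bcontfun.rep_eq intro!: exI[of _ "\<lambda>_. 0"])
  then have "\<exists>!y\<in>hull_compatible. picard y = y"
    by (intro Banach_fix[OF _ _ rate_nonneg small] picard_contraction)
       (auto simp: complete_eq_closed closed_hull_compatible picard_hull_compatible)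
  then obtain y where y: "y \<in> hull_compatible" "picard y = y" by blast
  show ?thesis
  proof (rule ex1I[of _ "apply_bcontfun y"])
    show "almost_automorphic (apply_bcontfun y) \<and> delay_solution \<tau> \<delta> p g (apply_bcontfun y)"
      using y assms by (simp add: hull_compatible_almost_automorphic delay_solution_iff_picard)
    fix z assume z: "almost_automorphic z \<and> delay_solution \<tau> \<delta> p g z"
    \<comment> \<open>A competing solution is bounded by almost automorphy, so it lifts to the
      function space where fixed points are unique.\<close>
    then have "z \<in> bcontfun"
      by (simp add: bcontfun_def almost_automorphic_bounded almost_automorphic_def)
    then obtain w where "z = apply_bcontfun w" by (rule bcontfunE)
    with z y(2) show "z = apply_bcontfun y"
      using picard_fixpoint_unique delay_solution_iff_picard by blast
  qed
qed

end

theorem theorem4p1: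
  fixes \<tau> \<delta>\<^sub>m :: real and \<delta> p :: "real \<Rightarrow> real"
  assumes "\<tau> > 0"
    and "almost_automorphic \<delta>" and "\<And>t. \<delta> t > 0"
    and "almost_automorphic p" and "\<And>t. p t > 0"
    and "ergodic \<delta>" and "mean \<delta> > \<delta>\<^sub>m" and "\<delta>\<^sub>m > 0"
  shows "\<exists>\<gamma>\<^sub>0 > 0. \<forall>\<gamma>. 0 < \<gamma> \<and> \<gamma> < \<gamma>\<^sub>0 \<longrightarrow>
    (\<forall>g :: real \<Rightarrow> real. (\<forall>x. g x > 0) \<and> \<gamma>-lipschitz_on UNIV g \<longrightarrow>
      (\<exists>!y. almost_automorphic y \<and> delay_solution \<tau> \<delta> p g y))"
proof -
  have cont: "continuous_on UNIV \<delta>" "continuous_on UNIV p"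
    using assms(2,4) by (auto simp: almost_automorphic_def)
  obtain A where "\<And>t. \<bar>\<delta> t\<bar> \<le> A"
    using almost_automorphic_bounded[OF assms(2)] unfolding bounded_range_real_iff by blast
  with has_mean_imp_dissipative[OF has_mean_mean assms(7,8) cont(1)] assms(3,6)
  obtain K where K: "dissipative A K \<delta>\<^sub>m \<delta>" by blast
  obtain P where P: "\<And>t. \<bar>p t\<bar> \<le> P"
    using almost_automorphic_bounded[OF assms(4)] unfolding bounded_range_real_iff by blast
  have pos: "K > 0" "P > 0"
    using dissipative_const_pos[OF K] P[of 0] assms(5)[of 0] by auto
  show ?thesis
  \<comment> \<open>The threshold is the contraction condition
    \<open>\<gamma> * P * K / \<delta>\<^sub>m < 1\<close> solved for \<open>\<gamma>\<close>;
    \<open>K\<close> and \<open>P\<close> are fixed before \<open>g\<close> is chosen.\<close>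
  proof (intro exI[of _ "\<delta>\<^sub>m / (P * K)"] conjI allI impI)
    show "\<delta>\<^sub>m / (P * K) > 0" using pos assms(8) by simp
    fix \<gamma> and g :: "real \<Rightarrow> real"
    assume \<gamma>: "0 < \<gamma> \<and> \<gamma> < \<delta>\<^sub>m / (P * K)" and g: "(\<forall>x. g x > 0) \<and> \<gamma>-lipschitz_on UNIV g"
    have "\<gamma> * P * K / \<delta>\<^sub>m < 1"
      using \<gamma> pos assms(8) by (simp add: field_simps)
    with g show "\<exists>!y. almost_automorphic y \<and> delay_solution \<tau> \<delta> p g y"
      by (intro ex1_almost_automorphic_solution[OF cont(1) K assms(8) cont(2) P _ _ assms(2,4)]) auto
  qed
qed

end
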